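(* Let $q$ be a prime power, $\ell\mid q-1$ and $s=(q-1)/\ell$. Let $\zeta\in\mathbb{F}_q$ be a primitive $\ell$-th root of unity, let $r_0,\ldots,r_{\ell-1}$ be positive integers and let $A_0,\ldots,A_{\ell-1}\in\mathbb{F}_q^*$. Then $$P(x)=\sum_{i=0}^{\ell-1}\frac{A_ix^{r_i}}{\ell\zeta^{i(\ell-1)}}\left(x^{(\ell-1)s}+\zeta^ix^{(\ell-2)s}+\cdots+\zeta^{i(\ell-2)}x^s+\zeta^{i(\ell-1)}\right)$$ is a permutation polynomial of $\mathbb{F}_q$ if and only if $\gcd(r_i,s)=1$ for all $i=0,\ldots,\ell-1$ and $\{A_i^s\zeta^{ir_i}\mid i=0,\ldots,\ell-1\}=\mu_\ell$, where $\mu_\ell$ is the set of all $\ell$-th roots of unity. The latter condition is equivalent to: $\{t_i+ir_i\mid i=0,\ldots,\ell-1\}$ is a complete set of residues modulo $\ell$, where $A_i^s=\zeta^{t_i}$ for $i=0,\ldots,\ell-1$. In particular, if $A_0^s=A_1^s=\cdots=A_{\ell-1}^s\neq 0$, then $P(x)$ is a permutation polynomial of $\mathbb{F}_q$ if and only if $\gcd(r_i,s)=1$ for all $i=0,\ldots,\ell-1$ and $\{ir_i\mid i=0,\ldots,\ell-1\}$ is a complete set of residues modulo $\ell$.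
   Context: A polynomial is a permutation polynomial (PP) of $\mathbb{F}_q$ if it induces a bijection of $\mathbb{F}_q$ to itself. *)

theory Defs
  imports
    "HOL-Computational_Algebra.Polynomial"
    "HOL-Number_Theory.Cong"
    "HOL-Library.Cardinality"
begin

definition permutation_polynomial :: "'a :: {field, finite} poly \<Rightarrow> bool" where
  "permutation_polynomial P \<longleftrightarrow> bij (poly P)"

definition roots_of_unity :: "nat \<Rightarrow> 'a :: field set" where
  "roots_of_unity l = {x. x ^ l = 1}"

definition primitive_root_of_unity :: "nat \<Rightarrow> 'a :: field \<Rightarrow> bool" where
  "primitive_root_of_unity l z \<longleftrightarrow> 0 < l \<and> z ^ l = 1 \<and> (\<forall>k. 0 < k \<and> k < l \<longrightarrow> z ^ k \<noteq> 1)"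

definition complete_residue_set :: "int \<Rightarrow> int set \<Rightarrow> bool" where
  "complete_residue_set m S \<longleftrightarrow> (\<forall>a. \<exists>!b. b \<in> S \<and> [b = a] (mod m))"

(* Only the values of A and r below l matter.  In the inner sum the index j runs through the
   summands from left to right, i.e. the j-th one is z^(i*j) * x^((l-1-j)*s); since j < l the
   natural-number subtractions are exact. *)
definition cyclotomic_mapping_poly ::
    "nat \<Rightarrow> nat \<Rightarrow> 'a :: field \<Rightarrow> (nat \<Rightarrow> 'a) \<Rightarrow> (nat \<Rightarrow> nat) \<Rightarrow> 'a poly" where
  "cyclotomic_mapping_poly l s z A r =
     (\<Sum>i<l. monom (A i / (of_nat l * z ^ (i * (l - 1)))) (r i) *
            (\<Sum>j<l. monom (z ^ (i * j)) ((l - 1 - j) * s)))"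

end

theory Submission
  imports Defs
begin

text \<open>
  Since \<open>l\<close> is invertible in the field, the inner sum is a multiple of the indicator function of
  the class \<open>{x. x ^ s = z ^ i}\<close>; hence \<open>P\<close> acts as \<open>x \<mapsto> A i * x ^ r i\<close> on that class. It maps the
  class of \<open>z ^ i\<close> into the class of \<open>A i ^ s * z ^ (i * r i)\<close>, so \<open>P\<close> is bijective iff it permutes
  the classes and is injective on each one. A class is a coset of the group of \<open>s\<close>-th roots of
  unity, on which \<open>x \<mapsto> x ^ r i\<close> is injective iff \<open>gcd (r i) s = 1\<close>.
\<close>

section \<open>Power maps on finite fields\<close>

text \<open>Multiplication by \<open>x\<close> permutes the nonzero elements, so their product
  absorbs the factor \<open>x ^ (CARD('a) - 1)\<close>; being nonzero, it cancels.\<close>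

lemma power_card_minus_one_eq_one:
  fixes x :: "'a :: {field, finite}"
  assumes "x \<noteq> 0"
  shows "x ^ (CARD('a) - 1) = 1"
proof -
  have "(\<Prod>y\<in>UNIV-{0}. x * y) = (\<Prod>y\<in>UNIV-{0}. y)"
    by (rule prod.reindex_bij_witness[of _ "\<lambda>y. y / x" "\<lambda>y. x * y"]) (use assms in auto)
  moreover have "(\<Prod>y\<in>UNIV-{0}. x * y) = x ^ (CARD('a) - 1) * (\<Prod>y\<in>UNIV-{0}. y)"
    by (simp add: prod.distrib)
  moreover have "(\<Prod>y\<in>UNIV-{0}. y :: 'a) \<noteq> 0"
    by simp
  ultimately show ?thesis
    by simp
qed

text \<open>Translation by 1 permutes the ring, hence leaves the sum of all elements
  unchanged.\<close>

lemma of_nat_card_eq_zero: "(of_nat (CARD('a)) :: 'a :: {ring_1, finite}) = 0"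
proof -
  have "(\<Sum>x\<in>(UNIV :: 'a set). x + 1) = (\<Sum>x\<in>(UNIV :: 'a set). x)"
    by (rule sum.reindex_bij_witness[of _ "\<lambda>y. y - 1" "\<lambda>y. y + 1"]) auto
  then show ?thesis
    by (simp add: sum.distrib)
qed

lemma card_power_eq_le:
  fixes c :: "'a :: {comm_ring_1, ring_no_zero_divisors}"
  assumes "0 < n"
  shows "card {x. x ^ n = c} \<le> n"
proof -
  define p :: "'a poly" where "p = monom 1 n - [:c:]"
  \<comment> \<open>Since \<open>0 < n\<close>, the constant \<open>c\<close> does not touch this
    coefficient, so \<open>p\<close> is nonzero.\<close>
  have coeff: "coeff p n = 1"
    using assms by (simp add: p_def coeff_pCons split: nat.split)
  have "{x. x ^ n = c} = {x. poly p x = 0}"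
    by (simp add: p_def poly_monom)
  also have "card \<dots> \<le> degree p"
    using coeff by (intro card_poly_roots_bound) auto
  also have "degree p \<le> n"
    unfolding p_def by (intro degree_diff_le) (auto simp: degree_monom_le)
  finally show ?thesis .
qed

text \<open>With \<open>CARD('a) - 1 = d * m\<close>, the equation \<open>x ^ m = 1\<close> has too
  few solutions to cover all nonzero elements. The \<open>m\<close>-th power of an exception is the
  desired root.\<close>

lemma exists_nontrivial_root_of_unity:
  assumes "d dvd CARD('a) - 1" "1 < d"
  obtains w :: "'a :: {field, finite}" where "w ^ d = 1" "w \<noteq> 1" "w \<noteq> 0"
proof -
  have "card {0, 1 :: 'a} \<le> CARD('a)"
    by (intro card_mono) auto
  then have pos: "0 < CARD('a) - 1"
    by simp
  obtain m where m: "CARD('a) - 1 = d * m"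
    using assms by blast
  have "0 < m"
    using pos m by (cases m) auto
  then have "m < d * m"
    using assms(2) by simp
  have "card {x :: 'a. x ^ m = 1} < card (UNIV - {0 :: 'a})"
    using le_less_trans[OF card_power_eq_le[OF \<open>0 < m\<close>] \<open>m < d * m\<close>] m by simp
  then have "\<not> UNIV - {0} \<subseteq> {x :: 'a. x ^ m = 1}"
    by (meson card_mono finite linorder_not_le)
  then obtain v :: 'a where v: "v \<noteq> 0" "v ^ m \<noteq> 1"
    by blast
  have "(v ^ m) ^ d = 1"
    using power_card_minus_one_eq_one[OF v(1)] unfolding m by (simp add: mult.commute flip: power_mult)
  with v show thesis
    using that[of "v ^ m"] by simp
qed

text \<open>A Bezout identity \<open>m * a = n * b + 1\<close> recovers a nonzero element from its
  \<open>m\<close>-th and \<open>n\<close>-th powers. Positivity of \<open>m\<close> allows natural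
  coefficients in this direction.\<close>

lemma eq_if_coprime_powers_eq:
  fixes x y :: "'a :: field"
  assumes "x ^ m = y ^ m" "x ^ n = y ^ n" "gcd m n = 1" "0 < m" "x \<noteq> 0"
  shows "x = y"
proof -
  obtain a b where ab: "m * a = n * b + 1"
    using bezout_nat[of m n] assms(3,4) by auto
  have bezout: "(w ^ n) ^ b * w = (w ^ m) ^ a" for w :: 'a
    by (simp add: ab flip: power_mult)
  have "(x ^ n) ^ b * x = (y ^ n) ^ b * y"
    unfolding bezout assms(1) ..
  then show ?thesis
    unfolding assms(2) using assms(2,4,5) by (auto simp: power_0_left)
qed

section \<open>Roots of unity\<close>

text \<open>A coincidence at exponents \<open>a < b < l\<close> would give
  \<open>z ^ (b - a) = 1\<close>, against the minimality of \<open>l\<close>.\<close>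

lemma primitive_root_power_eq_iff:
  assumes "primitive_root_of_unity l z" "i < l" "j < l"
  shows "z ^ i = z ^ j \<longleftrightarrow> i = j"
proof -
  have nz: "z \<noteq> 0"
    using assms(1) by (auto simp: primitive_root_of_unity_def power_0_left)
  have ne: "z ^ a \<noteq> z ^ b" if "a < b" "b < l" for a b
  proof
    assume "z ^ a = z ^ b"
    also have "z ^ b = z ^ a * z ^ (b - a)"
      using that by (simp flip: power_add)
    finally have "z ^ (b - a) = 1"
      using nz by simp
    moreover have "0 < b - a" "b - a < l"
      using that by auto
    ultimately show False
      using assms(1) unfolding primitive_root_of_unity_def by blast
  qed
  show ?thesis
    using ne[of i j] ne[of j i] assms(2,3) by (metis linorder_neqE_nat)
qed

text \<open>The powers are \<open>l\<close> distinct roots, and \<open>x ^ l = 1\<close> has at most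
  \<open>l\<close> solutions.\<close>

lemma roots_of_unity_eq_powers:
  fixes z :: "'a :: field"
  assumes "primitive_root_of_unity l z"
  shows "roots_of_unity l = (\<lambda>i. z ^ i) ` {..<l}"
    and "card (roots_of_unity l :: 'a set) = l"
proof -
  have l: "0 < l" "z ^ l = 1"
    using assms by (auto simp: primitive_root_of_unity_def)
  have card: "card ((\<lambda>i. z ^ i) ` {..<l}) = l"
    using primitive_root_power_eq_iff[OF assms] by (subst card_image) (auto simp: inj_on_def)
  have sub: "(\<lambda>i. z ^ i) ` {..<l} \<subseteq> roots_of_unity l"
  proof
    fix u assume "u \<in> (\<lambda>i. z ^ i) ` {..<l}"
    then obtain i where "u = z ^ i"
      by blast
    then have "u ^ l = (z ^ l) ^ i"
      by (simp only: mult.commute flip: power_mult)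
    then show "u \<in> roots_of_unity l"
      by (simp add: roots_of_unity_def l(2))
  qed
  \<comment> \<open>The field may be infinite here, and \<open>card\<close> is 0 on infinite sets,
    so the bound on \<open>card\<close> does not yield finiteness.\<close>
  have fin: "finite (roots_of_unity l :: 'a set)"
  proof -
    have "roots_of_unity l = {x :: 'a. poly (monom 1 l - [:1:]) x = 0}"
      by (simp add: roots_of_unity_def poly_monom)
    moreover have "coeff (monom 1 l - [:1:] :: 'a poly) l = 1"
      using l(1) by (simp add: coeff_pCons split: nat.split)
    then have "monom 1 l - [:1:] \<noteq> (0 :: 'a poly)"
      by force
    ultimately show ?thesis
      using poly_roots_finite by metis
  qed
  have "card (roots_of_unity l :: 'a set) \<le> l"
    using card_power_eq_le[OF l(1), of "1 :: 'a"] by (simp add: roots_of_unity_def)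
  then show eq: "roots_of_unity l = (\<lambda>i. z ^ i) ` {..<l}"
    using card_seteq[OF fin sub] unfolding card by blast
  show "card (roots_of_unity l :: 'a set) = l"
    using card eq by simp
qed

lemma power_int_mod_order:
  assumes "primitive_root_of_unity l z"
  shows "z powi a = z ^ nat (a mod int l)"
proof -
  have l: "0 < l" "z ^ l = 1" and nz: "z \<noteq> 0"
    using assms by (auto simp: primitive_root_of_unity_def power_0_left)
  have "z powi a = z powi (int l * (a div int l) + a mod int l)"
    by simp
  also have "\<dots> = z powi (a mod int l)"
    using nz l by (subst power_int_add) (simp_all add: power_int_mult)
  also have "\<dots> = z ^ nat (a mod int l)"
    using l by (simp add: power_int_nonneg_exp)
  finally show ?thesis .
qed

lemma primitive_root_powi_eq_iff:
  assumes "primitive_root_of_unity l z"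
  shows "z powi a = z powi b \<longleftrightarrow> [a = b] (mod int l)"
proof -
  have l: "0 < int l"
    using assms by (simp add: primitive_root_of_unity_def)
  have "z powi a = z powi b \<longleftrightarrow> nat (a mod int l) = nat (b mod int l)"
    unfolding power_int_mod_order[OF assms]
    by (rule primitive_root_power_eq_iff[OF assms]) (use l in \<open>simp_all add: nat_less_iff\<close>)
  also have "\<dots> \<longleftrightarrow> [a = b] (mod int l)"
    using l by (simp add: cong_def eq_nat_nat_iff)
  finally show ?thesis .
qed

lemma powi_mem_roots_of_unity:
  fixes z :: "'a :: field"
  assumes "primitive_root_of_unity l z"
  shows "z powi a \<in> roots_of_unity l"
proof -
  have "nat (a mod int l) < l"
    using assms by (simp add: primitive_root_of_unity_def nat_less_iff)
  then show ?thesis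
    unfolding roots_of_unity_eq_powers(1)[OF assms] power_int_mod_order[OF assms] by blast
qed

text \<open>\<open>z powi a\<close> identifies residues modulo \<open>l\<close> with
  \<open>l\<close>-th roots of unity, so covering all residues amounts to covering all
  roots.\<close>

lemma roots_of_unity_eq_iff_complete_residue_set:
  fixes z :: "'a :: field"
  assumes "primitive_root_of_unity l z"
  shows "{z powi t i | i. i < l} = roots_of_unity l \<longleftrightarrow>
    complete_residue_set (int l) {t i | i. i < l}"
proof
  assume eq: "{z powi t i | i. i < l} = roots_of_unity l"
  \<comment> \<open>As \<open>l\<close> indices cover \<open>l\<close> roots, no two share a root;
    this yields the uniqueness part of \<open>complete_residue_set\<close>.\<close>
  have "card ((\<lambda>i. z powi t i) ` {..<l}) = card {..<l}"
    using eq roots_of_unity_eq_powers(2)[OF assms]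
    by (simp add: setcompr_eq_image lessThan_def)
  then have inj: "inj_on (\<lambda>i. z powi t i) {..<l}"
    by (intro eq_card_imp_inj_on) auto
  show "complete_residue_set (int l) {t i | i. i < l}"
    unfolding complete_residue_set_def
  proof
    fix a
    have "z powi a \<in> {z powi t i | i. i < l}"
      using powi_mem_roots_of_unity[OF assms] eq by simp
    then obtain i where i: "i < l" "z powi a = z powi t i"
      by blast
    show "\<exists>!b. b \<in> {t i | i. i < l} \<and> [b = a] (mod int l)"
    proof (intro ex1I[of _ "t i"] conjI)
      show "t i \<in> {t i | i. i < l}"
        using i by blast
      show "[t i = a] (mod int l)"
        using i by (simp flip: primitive_root_powi_eq_iff[OF assms])
      fix b assume b: "b \<in> {t i | i. i < l} \<and> [b = a] (mod int l)"
      then obtain j where j: "j < l" "b = t j"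
        by blast
      have "z powi t j = z powi t i"
        using b j i by (simp flip: primitive_root_powi_eq_iff[OF assms])
      then show "b = t i"
        using inj_onD[OF inj, of j i] i j by simp
    qed
  qed
next
  assume crs: "complete_residue_set (int l) {t i | i. i < l}"
  show "{z powi t i | i. i < l} = roots_of_unity l"
  proof
    show "{z powi t i | i. i < l} \<subseteq> roots_of_unity l"
      using powi_mem_roots_of_unity[OF assms] by blast
    show "roots_of_unity l \<subseteq> {z powi t i | i. i < l}"
    proof
      fix u :: 'a assume "u \<in> roots_of_unity l"
      then obtain k where k: "u = z powi int k"
        unfolding roots_of_unity_eq_powers(1)[OF assms] by auto
      obtain i where "i < l" "[t i = int k] (mod int l)"
        using crs unfolding complete_residue_set_def by blast
      then have "i < l" "u = z powi t i"
        by (simp_all add: k primitive_root_powi_eq_iff[OF assms] cong_sym del: power_int_of_nat)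
      then show "u \<in> {z powi t i | i. i < l}"
        by blast
    qed
  qed
qed

text \<open>Multiplying by \<open>w - y\<close> telescopes the sum to
  \<open>w ^ l - y ^ l = 0\<close>. It is applied with \<open>w = z ^ i\<close> and
  \<open>y = x ^ s\<close>.\<close>

lemma sum_powers_roots_of_unity:
  fixes w y :: "'a :: idom"
  assumes "w ^ l = 1" "y ^ l = 1"
  shows "(\<Sum>j<l. w ^ j * y ^ (l - 1 - j)) = (if y = w then of_nat l * w ^ (l - 1) else 0)"
proof (cases "y = w")
  case True
  have "(\<Sum>j<l. w ^ j * w ^ (l - 1 - j)) = (\<Sum>j<l. w ^ (l - 1))"
    by (intro sum.cong) (auto simp flip: power_add)
  with True show ?thesis
    by simp
next
  case False
  have "(w - y) * (\<Sum>j<l. w ^ j * y ^ (l - 1 - j)) = 0"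
    using power_diff_sumr2[of w l y] assms by (simp add: mult.commute)
  with False show ?thesis
    by simp
qed

section \<open>The piecewise monomial mapping\<close>

locale cyclotomic_mapping =
  fixes l s :: nat
    and z :: "'a :: {field, finite}"
    and r :: "nat \<Rightarrow> nat"
    and A :: "nat \<Rightarrow> 'a"
  assumes card_minus_one: "CARD('a) - 1 = l * s"
    and primitive: "primitive_root_of_unity l z"
    and r_pos: "i < l \<Longrightarrow> 0 < r i"
    and A_nonzero: "i < l \<Longrightarrow> A i \<noteq> 0"
begin

abbreviation P :: "'a poly" where
  "P \<equiv> cyclotomic_mapping_poly l s z A r"

section \<open>Field size and the \<open>s\<close>-th power map\<close>

lemma card_eq: "CARD('a) = l * s + 1"
proof -
  have "0 < CARD('a)"
    by simp
  then show ?thesis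
    using card_minus_one by linarith
qed

lemma s_pos: "0 < s"
proof (rule ccontr)
  assume "\<not> 0 < s"
  then have "CARD('a) = 1"
    using card_eq by simp
  moreover have "card {0, 1 :: 'a} \<le> CARD('a)"
    by (intro card_mono) auto
  ultimately show False
    by simp
qed

lemma l_pos: "0 < l" and z_pow: "z ^ l = 1"
  using primitive by (auto simp: primitive_root_of_unity_def)

lemma power_z_power_l: "(z ^ i) ^ l = 1"
proof -
  have "(z ^ i) ^ l = (z ^ l) ^ i"
    by (simp only: mult.commute flip: power_mult)
  then show ?thesis
    by (simp add: z_pow)
qed

lemma z_nonzero: "z \<noteq> 0"
  using l_pos z_pow by (auto simp: power_0_left)

text \<open>Otherwise \<open>CARD('a) = l * s + 1\<close> would map to 1 in the field, where it is
  0.\<close>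

lemma of_nat_l_nonzero: "(of_nat l :: 'a) \<noteq> 0"
proof
  assume "(of_nat l :: 'a) = 0"
  then have "(of_nat (CARD('a)) :: 'a) = 1"
    unfolding card_eq by simp
  then show False
    by (simp add: of_nat_card_eq_zero)
qed

lemma power_s_mem_roots_of_unity:
  fixes x :: 'a
  assumes "x \<noteq> 0"
  shows "x ^ s \<in> roots_of_unity l"
  using power_card_minus_one_eq_one[OF assms] unfolding card_minus_one
  by (simp add: roots_of_unity_def mult.commute flip: power_mult)

lemma power_s_eq_power:
  fixes x :: 'a
  assumes "x \<noteq> 0"
  obtains i where "i < l" "x ^ s = z ^ i"
  using power_s_mem_roots_of_unity[OF assms] roots_of_unity_eq_powers(1)[OF primitive] by auto

text \<open>Every fibre of \<open>x \<mapsto> x ^ s\<close> has at most \<open>s\<close> elements, so the image has at least \<open>l\<close>.\<close>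

lemma image_power_s: "(\<lambda>x :: 'a. x ^ s) ` (UNIV - {0}) = roots_of_unity l"
proof -
  define I where "I = (\<lambda>x :: 'a. x ^ s) ` (UNIV - {0})"
  have sub: "I \<subseteq> roots_of_unity l"
    using power_s_mem_roots_of_unity by (auto simp: I_def)
  have "UNIV - {0 :: 'a} \<subseteq> (\<Union>u\<in>I. {x. x ^ s = u})"
    by (auto simp: I_def)
  then have "card (UNIV - {0 :: 'a}) \<le> card (\<Union>u\<in>I. {x :: 'a. x ^ s = u})"
    by (rule card_mono[OF finite])
  also have "\<dots> \<le> (\<Sum>u\<in>I. card {x :: 'a. x ^ s = u})"
    by (rule card_UN_le[OF finite])
  also have "\<dots> \<le> (\<Sum>u\<in>I. s)"
    by (intro sum_mono card_power_eq_le s_pos)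
  finally have "l * s \<le> card I * s"
    using card_minus_one by simp
  then have "card (roots_of_unity l :: 'a set) \<le> card I"
    unfolding roots_of_unity_eq_powers(2)[OF primitive] using s_pos by simp
  then show ?thesis
    using card_seteq[OF finite sub] by (simp add: I_def)
qed

lemma exists_power_s_eq:
  assumes "u \<in> roots_of_unity l"
  obtains x :: 'a where "x \<noteq> 0" "x ^ s = u"
proof -
  have "u \<in> (\<lambda>x. x ^ s) ` (UNIV - {0})"
    unfolding image_power_s by (rule assms)
  then show thesis
    using that by blast
qed

section \<open>Values of \<open>P\<close> on the classes\<close>

lemma poly_cyclotomic:
  "poly P x = (\<Sum>i<l. A i / (of_nat l * z ^ (i * (l - 1))) * x ^ r i *
     (\<Sum>j<l. (z ^ i) ^ j * (x ^ s) ^ (l - 1 - j)))"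
proof -
  have "poly (monom (z ^ (i * j)) ((l - 1 - j) * s)) x = (z ^ i) ^ j * (x ^ s) ^ (l - 1 - j)"
    for i j
    by (simp only: poly_monom mult.commute flip: power_mult)
  then show ?thesis
    by (simp only: cyclotomic_mapping_poly_def poly_sum poly_mult poly_monom)
qed

lemma poly_zero: "poly P 0 = 0"
  unfolding poly_cyclotomic
  by (intro sum.neutral ballI) (simp add: r_pos zero_power)

text \<open>Only the summand \<open>i = k\<close> survives, and its inner sum cancels the
  denominator \<open>of_nat l * z ^ (k * (l - 1))\<close>.\<close>

lemma poly_eq_monomial:
  assumes "k < l" "x ^ s = z ^ k"
  shows "poly P x = A k * x ^ r k"
proof -
  have inner: "(\<Sum>j<l. (z ^ i) ^ j * (x ^ s) ^ (l - 1 - j)) =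
      (if i = k then of_nat l * z ^ (k * (l - 1)) else 0)" if "i < l" for i
    unfolding assms(2) sum_powers_roots_of_unity[OF power_z_power_l power_z_power_l]
      primitive_root_power_eq_iff[OF primitive assms(1) that]
    by (auto simp: power_mult)
  have "poly P x = (\<Sum>i<l. if i = k then A k * x ^ r k else 0)"
    unfolding poly_cyclotomic
    by (intro sum.cong refl) (use of_nat_l_nonzero z_nonzero inner in auto)
  also have "\<dots> = A k * x ^ r k"
    using assms(1) by simp
  finally show ?thesis .
qed

lemma poly_nonzero:
  assumes "x \<noteq> 0"
  shows "poly P x \<noteq> 0"
proof -
  obtain i where "i < l" "x ^ s = z ^ i"
    using power_s_eq_power[OF assms] .
  then show ?thesis
    using poly_eq_monomial A_nonzero assms by simp
qed

text \<open>The right-hand side depends on \<open>k\<close> alone, so \<open>P\<close> induces a map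
  on classes.\<close>

lemma poly_power_s:
  assumes "k < l" "x ^ s = z ^ k"
  shows "poly P x ^ s = A k ^ s * z ^ (k * r k)"
proof -
  have "poly P x ^ s = A k ^ s * (x ^ s) ^ r k"
    by (simp add: poly_eq_monomial[OF assms] power_mult_distrib mult.commute flip: power_mult)
  then show ?thesis
    by (simp add: assms(2) power_mult)
qed

section \<open>The bijectivity criterion\<close>

lemma inj_poly:
  assumes gcd: "\<And>i. i < l \<Longrightarrow> gcd (r i) s = 1"
    and eq: "{A i ^ s * z ^ (i * r i) | i. i < l} = roots_of_unity l"
  shows "inj (poly P)"
proof (rule injI)
  \<comment> \<open>Covering \<open>l\<close> roots with \<open>l\<close> indices makes the induced
    map on classes injective.\<close>
  have "card ((\<lambda>i. A i ^ s * z ^ (i * r i)) ` {..<l}) = card {..<l}"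
    using eq roots_of_unity_eq_powers(2)[OF primitive]
    by (simp add: setcompr_eq_image lessThan_def)
  then have inj: "inj_on (\<lambda>i. A i ^ s * z ^ (i * r i)) {..<l}"
    by (intro eq_card_imp_inj_on) auto
  fix x y assume xy: "poly P x = poly P y"
  show "x = y"
  proof (cases "x = 0 \<or> y = 0")
    case True
    then have "poly P x = 0" "poly P y = 0"
      using xy poly_zero by auto
    then show ?thesis
      using poly_nonzero[of x] poly_nonzero[of y] by auto
  next
    case False
    then have "x \<noteq> 0" "y \<noteq> 0"
      by simp_all
    obtain i where i: "i < l" "x ^ s = z ^ i"
      using power_s_eq_power[OF \<open>x \<noteq> 0\<close>] .
    obtain j where j: "j < l" "y ^ s = z ^ j"
      using power_s_eq_power[OF \<open>y \<noteq> 0\<close>] .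
    have "A i ^ s * z ^ (i * r i) = A j ^ s * z ^ (j * r j)"
      using xy poly_power_s[OF i] poly_power_s[OF j] by simp
    then have "i = j"
      using inj_onD[OF inj] i j by simp
    moreover have "A i * x ^ r i = A j * y ^ r j"
      using xy poly_eq_monomial[OF i] poly_eq_monomial[OF j] by simp
    \<comment> \<open>Once the classes agree, the common factor \<open>A i\<close> cancels, leaving
      two power equations with coprime exponents.\<close>
    ultimately have "x ^ r i = y ^ r i" "x ^ s = y ^ s"
      using A_nonzero[OF i(1)] i j by auto
    then show ?thesis
      by (rule eq_if_coprime_powers_eq) (fact gcd[OF i(1)] r_pos[OF i(1)] \<open>x \<noteq> 0\<close>)+
  qed
qed

text \<open>If \<open>?d > 1\<close> divides both \<open>r i\<close> and \<open>s\<close>, scaling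
  by a nontrivial \<open>?d\<close>-th root of unity \<open>w\<close> changes neither
  \<open>x ^ s\<close> nor \<open>x ^ r i\<close>, so \<open>P\<close> takes the same value at
  \<open>x\<close> and \<open>x * w\<close>.\<close>

lemma gcd_eq_one_if_inj:
  assumes "inj (poly P)" "i < l"
  shows "gcd (r i) s = 1"
proof (rule ccontr)
  let ?d = "gcd (r i) s"
  assume "?d \<noteq> 1"
  moreover have "?d > 0"
    using s_pos by simp
  ultimately have "1 < ?d"
    by linarith
  have "?d dvd CARD('a) - 1"
    unfolding card_minus_one by simp
  then obtain w :: 'a where w: "w ^ ?d = 1" "w \<noteq> 1" "w \<noteq> 0"
    using \<open>1 < ?d\<close> by (rule exists_nontrivial_root_of_unity)
  have dvd: "w ^ n = 1" if "?d dvd n" for n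
    using that w(1) by (auto simp: dvd_def power_mult)
  have "z ^ i \<in> roots_of_unity l"
    using roots_of_unity_eq_powers(1)[OF primitive] assms(2) by blast
  then obtain x :: 'a where x: "x \<noteq> 0" "x ^ s = z ^ i"
    by (rule exists_power_s_eq)
  have "(x * w) ^ s = z ^ i"
    using x dvd[of s] by (simp add: power_mult_distrib)
  then have "poly P (x * w) = poly P x"
    using x poly_eq_monomial[OF assms(2)] dvd[of "r i"] by (simp add: power_mult_distrib)
  then have "x * w = x"
    using injD[OF assms(1)] by blast
  then show False
    using x w by simp
qed

text \<open>Every root \<open>u\<close> is \<open>y ^ s\<close> for some nonzero \<open>y\<close>;
  the class of a preimage of \<open>y\<close> supplies the index.\<close>

lemma image_classes_if_surj:
  assumes "surj (poly P)"
  shows "{A i ^ s * z ^ (i * r i) | i. i < l} = roots_of_unity l"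
proof
  show "{A i ^ s * z ^ (i * r i) | i. i < l} \<subseteq> roots_of_unity l"
  proof
    fix u assume "u \<in> {A i ^ s * z ^ (i * r i) | i. i < l}"
    then obtain i where i: "i < l" "u = A i ^ s * z ^ (i * r i)"
      by blast
    have "A i ^ s \<in> roots_of_unity l"
      using power_s_mem_roots_of_unity A_nonzero i by blast
    moreover have "(z ^ (i * r i)) ^ l = 1"
      by (rule power_z_power_l)
    ultimately show "u \<in> roots_of_unity l"
      by (simp add: roots_of_unity_def i(2) power_mult_distrib)
  qed
  show "roots_of_unity l \<subseteq> {A i ^ s * z ^ (i * r i) | i. i < l}"
  proof
    fix u :: 'a assume "u \<in> roots_of_unity l"
    then obtain y where y: "y \<noteq> 0" "y ^ s = u"
      by (rule exists_power_s_eq)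
    obtain x where x: "y = poly P x"
      using assms by (metis surjD)
    then have "x \<noteq> 0"
      using y poly_zero by auto
    then obtain i where i: "i < l" "x ^ s = z ^ i"
      by (rule power_s_eq_power)
    then have "u = A i ^ s * z ^ (i * r i)"
      using poly_power_s[OF i] x y by simp
    then show "u \<in> {A i ^ s * z ^ (i * r i) | i. i < l}"
      using i(1) by blast
  qed
qed

lemma permutation_polynomial_iff:
  "permutation_polynomial P \<longleftrightarrow>
     (\<forall>i<l. gcd (r i) s = 1) \<and> {A i ^ s * z ^ (i * r i) | i. i < l} = roots_of_unity l"
proof
  assume "permutation_polynomial P"
  then have "inj (poly P)" "surj (poly P)"
    by (auto simp: permutation_polynomial_def bij_def)
  then show "(\<forall>i<l. gcd (r i) s = 1) \<and>
      {A i ^ s * z ^ (i * r i) | i. i < l} = roots_of_unity l"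
    using gcd_eq_one_if_inj image_classes_if_surj by blast
next
  assume "(\<forall>i<l. gcd (r i) s = 1) \<and>
      {A i ^ s * z ^ (i * r i) | i. i < l} = roots_of_unity l"
  then have "inj (poly P)"
    using inj_poly by blast
  then show "permutation_polynomial P"
    using finite_UNIV_inj_surj[OF finite] by (simp add: permutation_polynomial_def bij_def)
qed

section \<open>Exponents and residues modulo \<open>l\<close>\<close>

text \<open>Ensures that the equivalence with complete residue sets, stated for all such
  \<open>t\<close>, is not vacuous.\<close>

lemma exists_exponents: "\<exists>t :: nat \<Rightarrow> int. \<forall>i<l. A i ^ s = z powi t i"
proof -
  have "\<exists>k :: int. A i ^ s = z powi k" if i: "i < l" for i
  proof -
    obtain k where "A i ^ s = z ^ k"
      using power_s_eq_power[OF A_nonzero[OF i]] by blast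
    then have "A i ^ s = z powi int k"
      by simp
    then show ?thesis ..
  qed
  then show ?thesis
    by metis
qed

lemma image_classes_iff_complete_residue_set:
  assumes "\<forall>i<l. A i ^ s = z powi t i"
  shows "{A i ^ s * z ^ (i * r i) | i. i < l} = roots_of_unity l \<longleftrightarrow>
    complete_residue_set (int l) {t i + int (i * r i) | i. i < l}"
proof -
  have "A i ^ s * z ^ (i * r i) = z powi (t i + int (i * r i))" if "i < l" for i
    using assms that z_nonzero by (simp add: power_int_add flip: power_int_of_nat)
  then have "{A i ^ s * z ^ (i * r i) | i. i < l} = {z powi (t i + int (i * r i)) | i. i < l}"
    by (metis (no_types, lifting))
  then show ?thesis
    using roots_of_unity_eq_iff_complete_residue_set[OF primitive, of "\<lambda>i. t i + int (i * r i)"]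
    by simp
qed

end

text \<open>Translation permutes the residues. This removes the constant exponent when all
  \<open>A i ^ s\<close> coincide.\<close>

lemma complete_residue_set_translate:
  "complete_residue_set m {c + f i | i. i < n} \<longleftrightarrow>
    complete_residue_set m {f i | i. i < (n :: nat)}"
proof -
  have shift: "complete_residue_set m ((+) d ` S)" if "complete_residue_set m S" for d S
    unfolding complete_residue_set_def
  proof
    fix a
    have "\<exists>!b. b \<in> S \<and> [b = a - d] (mod m)"
      using that unfolding complete_residue_set_def by (rule spec)
    then obtain b where b: "b \<in> S" "[b = a - d] (mod m)"
      and unique: "\<forall>b'. b' \<in> S \<and> [b' = a - d] (mod m) \<longrightarrow> b' = b"
      by (elim ex1E) blast
    have cong: "[d + e = a] (mod m) \<longleftrightarrow> [e = a - d] (mod m)" for e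
      by (simp add: cong_iff_dvd_diff algebra_simps)
    show "\<exists>!b. b \<in> (+) d ` S \<and> [b = a] (mod m)"
    proof (intro ex1I[of _ "d + b"] conjI)
      show "d + b \<in> (+) d ` S" "[d + b = a] (mod m)"
        unfolding cong using b by blast+
      fix b' assume b': "b' \<in> (+) d ` S \<and> [b' = a] (mod m)"
      then obtain e where e: "e \<in> S" "b' = d + e"
        by blast
      then have "[e = a - d] (mod m)"
        using b' cong by blast
      then show "b' = d + b"
        using e unique by blast
    qed
  qed
  define T where "T = {f i | i. i < n}"
  have eq: "{c + f i | i. i < n} = (+) c ` T"
    unfolding T_def by blast
  \<comment> \<open>Shifting back by \<open>- c\<close> gives the converse implication.\<close>
  have "(+) (- c) ` (+) c ` T = T"
    by (simp add: image_image)
  then show ?thesis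
    unfolding eq T_def[symmetric] using shift[of T c] shift[of "(+) c ` T" "- c"] by metis
qed

theorem theorem2p19:
  fixes q l s :: nat
    and z :: "'a :: {field, finite}"
    and r :: "nat \<Rightarrow> nat"
    and A :: "nat \<Rightarrow> 'a"
    and P :: "'a poly"
  assumes "q = CARD('a)"
    and "l dvd q - 1"
    and "s = (q - 1) div l"
    and "primitive_root_of_unity l z"
    and "\<forall>i<l. 0 < r i"
    and "\<forall>i<l. A i \<noteq> 0"
    and "P = cyclotomic_mapping_poly l s z A r"
  shows
    "(permutation_polynomial P \<longleftrightarrow>
        (\<forall>i<l. gcd (r i) s = 1) \<and>
        {A i ^ s * z ^ (i * r i) | i. i < l} = roots_of_unity l)
     \<and> (\<exists>t :: nat \<Rightarrow> int. \<forall>i<l. A i ^ s = z powi t i)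
     \<and> (\<forall>t :: nat \<Rightarrow> int. (\<forall>i<l. A i ^ s = z powi t i) \<longrightarrow>
          ({A i ^ s * z ^ (i * r i) | i. i < l} = roots_of_unity l \<longleftrightarrow>
           complete_residue_set (int l) {t i + int (i * r i) | i. i < l}))
     \<and> ((\<forall>i<l. A i ^ s = A 0 ^ s) \<and> A 0 ^ s \<noteq> 0 \<longrightarrow>
          (permutation_polynomial P \<longleftrightarrow>
             (\<forall>i<l. gcd (r i) s = 1) \<and>
             complete_residue_set (int l) {int (i * r i) | i. i < l}))"
proof -
  have "CARD('a) - 1 = l * s"
    using assms(1-3) by simp
  then interpret cyclotomic_mapping l s z r A
    by unfold_locales (use assms in auto)
  have const: "permutation_polynomial P \<longleftrightarrow>
      (\<forall>i<l. gcd (r i) s = 1) \<and> complete_residue_set (int l) {int (i * r i) | i. i < l}"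
    if "\<forall>i<l. A i ^ s = A 0 ^ s"
  proof -
    \<comment> \<open>One exponent \<open>c\<close> serves for every index, so \<open>t\<close> can
      be taken constant.\<close>
    obtain c where "A 0 ^ s = z powi c"
      using exists_exponents l_pos by blast
    with that have "\<forall>i<l. A i ^ s = z powi c"
      by simp
    then have "{A i ^ s * z ^ (i * r i) | i. i < l} = roots_of_unity l \<longleftrightarrow>
        complete_residue_set (int l) {int (i * r i) | i. i < l}"
      using image_classes_iff_complete_residue_set[of "\<lambda>_. c"]
        complete_residue_set_translate[of "int l" c "\<lambda>i. int (i * r i)" l] by blast
    then show ?thesis
      using permutation_polynomial_iff assms(7) by simp
  qed
  show ?thesis
    using permutation_polynomial_iff exists_exponents image_classes_iff_complete_residue_set const
    unfolding assms(7) by blast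
qed

end
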